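(* For all integers $n,m\ge0$, with $\underline{n}:=\bigcup_{y\in Y_n}y=Y_n$ the total grove of degree $n$, one has $\underline{n}\times\underline{m}=\underline{nm}$.
   Context: A planar binary tree of degree $n\ge 0$ is a planar rooted tree (up to planar isotopy) with $n+1$ leaves in which every internal vertex has exactly two inputs; $Y_n$ is the set of these trees, $Y_0=\{|\}$, and the unique tree of $Y_1$ is denoted $1$. For $x\in Y_p$, $y\in Y_q$ the grafting $x\vee y\in Y_{p+q+1}$ joins the roots of $x$ and $y$ to a new vertex with a new root; every $x\in Y_n$, $n\ge1$, decomposes uniquely as $x=x^l\vee x^r$. Tamari order on $Y_n$: the smallest partial order with $(a\vee b)\vee c\le a\vee(b\vee c)$, and $a\le b\Rightarrow a\vee c\le b\vee c,\ c\vee a\le c\vee b$. $x/y$ identifies the root of $x$ with the leftmost leaf of $y$; $x\backslash y$ identifies the rightmost leaf of $x$ with the root of $y$. Sum of trees: $x+y:=\{z\in Y_{p+q}: x/y\le z\le x\backslash y\}$. A grove is a nonempty subset of some $Y_n$; all operations on groves are extended from trees by distributivity (union over pairs, counted with multiplicity), and grafting with a grove is elementwise. Left/Right sums of trees: $x\dashv y:=x^l\vee(x^r+y)$ for $x\ne|$, $x\vdash y:=(x+y^l)\vee y^r$ for $y\ne|$, $|\dashv y=|=y\vdash|$ for $y\ne|$, and by convention $|\dashv|=|\vdash|=|$. Product: for a tree $x$ and a grove $y$ define $W_|(y):=|$ and $W_x(y):=(W_{x^l}(y)\vdash y)\dashv W_{x^r}(y)$ for $x=x^l\vee x^r$; set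 $x\times y:=W_x(y)$, and for a grove $X$, $X\times y:=\bigcup_{x\in X}x\times y$.
   Formalization: Equality is proved as sets of trees for all n, m, and also with multiplicity except when m = 0 and n ≥ 2; there the union over Y_n, counted with multiplicity, gives several copies of |, so the equality holds only as sets. *)

theory Defs
  imports "HOL-Library.Multiset"
begin

text \<open>Planar rooted binary trees up to planar isotopy; \<open>Bar\<close> is the tree without internal
  vertex and \<open>Vee x y\<close> is the grafting of \<open>x\<close> and \<open>y\<close>.\<close>

datatype pbt = Bar | Vee pbt pbt

primrec leaves :: "pbt \<Rightarrow> nat" where
  "leaves Bar = 1"
| "leaves (Vee x y) = leaves x + leaves y"

definition Y :: "nat \<Rightarrow> pbt set" where
  "Y n = {t. leaves t = n + 1}"

definition degree :: "pbt \<Rightarrow> nat" where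
  "degree t = leaves t - 1"

lemma leaves_pos: "leaves t \<ge> 1"
  by (induction t) auto

text \<open>Finiteness matters because \<open>mset_set\<close> is empty on infinite sets.\<close>

lemma finite_leaves_le: "finite {t. leaves t \<le> n}"
proof (induction n)
  case 0
  have "{t. leaves t \<le> 0} = {}"
  proof -
    have "\<not> leaves t \<le> 0" for t
      using leaves_pos[of t] by linarith
    then show ?thesis by blast
  qed
  then show ?case by (simp only: finite.emptyI)
next
  case (Suc n)
  let ?A = "{t. leaves t \<le> n}"
  have "{t. leaves t \<le> Suc n} \<subseteq> insert Bar ((\<lambda>(l, r). Vee l r) ` (?A \<times> ?A))"
  proof
    fix t assume t: "t \<in> {t. leaves t \<le> Suc n}"
    show "t \<in> insert Bar ((\<lambda>(l, r). Vee l r) ` (?A \<times> ?A))"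
    proof (cases t)
      case (Vee l r)
      then have "leaves l \<le> n" "leaves r \<le> n"
        using t leaves_pos[of l] leaves_pos[of r] by auto
      then show ?thesis using Vee by auto
    qed simp
  qed
  then show ?case using Suc by (meson finite_SigmaI finite_imageI finite_insert finite_subset)
qed

lemma finite_Y: "finite (Y n)"
  by (rule finite_subset[OF _ finite_leaves_le[of "n + 1"]]) (auto simp: Y_def)

text \<open>The inductive definition yields the least preorder with the two properties of the Tamari
  order.  It preserves the degree and is antisymmetric (both shown below), hence it is on each
  \<open>Y n\<close> the least partial order with these properties.\<close>

inductive tamari :: "pbt \<Rightarrow> pbt \<Rightarrow> bool" (infix "\<le>\<^sub>T" 50) where
  refl: "a \<le>\<^sub>T a"
| trans: "a \<le>\<^sub>T b \<Longrightarrow> b \<le>\<^sub>T c \<Longrightarrow> a \<le>\<^sub>T c"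
| assoc: "Vee (Vee a b) c \<le>\<^sub>T Vee a (Vee b c)"
| graft_left: "a \<le>\<^sub>T b \<Longrightarrow> Vee a c \<le>\<^sub>T Vee b c"
| graft_right: "a \<le>\<^sub>T b \<Longrightarrow> Vee c a \<le>\<^sub>T Vee c b"

lemma tamari_leaves: "a \<le>\<^sub>T b \<Longrightarrow> leaves a = leaves b"
  by (induction rule: tamari.induct) auto

primrec right_weight :: "pbt \<Rightarrow> nat" where
  "right_weight Bar = 0"
| "right_weight (Vee x y) = right_weight x + right_weight y + leaves y"

lemma tamari_right_weight: "a \<le>\<^sub>T b \<Longrightarrow> a = b \<or> right_weight a < right_weight b"
proof (induction rule: tamari.induct)
  case (assoc a b c)
  then show ?case using leaves_pos[of c] by simp
qed (auto dest: tamari_leaves)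

lemma tamari_antisym: "a \<le>\<^sub>T b \<Longrightarrow> b \<le>\<^sub>T a \<Longrightarrow> a = b"
  using tamari_right_weight[of a b] tamari_right_weight[of b a] by auto

text \<open>\<open>over x y\<close> is \<open>x / y\<close> (root of \<open>x\<close> on the leftmost leaf of \<open>y\<close>); \<open>under x y\<close> is \<open>x\<close>
  backslash \<open>y\<close> (root of \<open>y\<close> on the rightmost leaf of \<open>x\<close>).\<close>

primrec over :: "pbt \<Rightarrow> pbt \<Rightarrow> pbt" where
  "over x Bar = x"
| "over x (Vee l r) = Vee (over x l) r"

primrec under :: "pbt \<Rightarrow> pbt \<Rightarrow> pbt" where
  "under Bar y = y"
| "under (Vee l r) y = Vee l (under r y)"

text \<open>Unions of trees are counted with multiplicity, so they are multisets; a grove is the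
  special case \<open>mset_set A\<close> with \<open>A\<close> a nonempty subset of some \<open>Y n\<close>.\<close>

definition tree_sum :: "pbt \<Rightarrow> pbt \<Rightarrow> pbt multiset" where
  "tree_sum x y = mset_set {z \<in> Y (degree x + degree y). over x y \<le>\<^sub>T z \<and> z \<le>\<^sub>T under x y}"

text \<open>The \<open>Bar\<close> equations of the next two functions include the convention that the left and
  right sums of \<open>Bar\<close> with \<open>Bar\<close> are both \<open>Bar\<close>.\<close>

fun tree_left_sum :: "pbt \<Rightarrow> pbt \<Rightarrow> pbt multiset" where
  "tree_left_sum Bar y = {#Bar#}"
| "tree_left_sum (Vee l r) y = image_mset (\<lambda>z. Vee l z) (tree_sum r y)"

fun tree_right_sum :: "pbt \<Rightarrow> pbt \<Rightarrow> pbt multiset" where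
  "tree_right_sum x Bar = {#Bar#}"
| "tree_right_sum x (Vee l r) = image_mset (\<lambda>z. Vee z r) (tree_sum x l)"

definition left_sum :: "pbt multiset \<Rightarrow> pbt multiset \<Rightarrow> pbt multiset" (infixl "\<stileturn>" 65) where
  "A \<stileturn> B = (\<Sum>x\<in>#A. \<Sum>y\<in>#B. tree_left_sum x y)"

definition right_sum :: "pbt multiset \<Rightarrow> pbt multiset \<Rightarrow> pbt multiset" (infixl "\<turnstile>" 65) where
  "A \<turnstile> B = (\<Sum>x\<in>#A. \<Sum>y\<in>#B. tree_right_sum x y)"

primrec W :: "pbt \<Rightarrow> pbt multiset \<Rightarrow> pbt multiset" where
  "W Bar y = {#Bar#}"
| "W (Vee l r) y = (W l y \<turnstile> y) \<stileturn> W r y"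

text \<open>Pitfall: if \<open>y = {#Bar#}\<close>, then \<open>W x y = {#Bar#}\<close> for every \<open>x\<close>, so the product of \<open>X\<close> with
  \<open>{#Bar#}\<close> consists of \<open>size X\<close> copies of \<open>Bar\<close>.  It agrees with the grove \<open>{Bar}\<close> as a set of trees,
  but with multiplicity only if \<open>size X = 1\<close>.\<close>

definition grove_product :: "pbt multiset \<Rightarrow> pbt multiset \<Rightarrow> pbt multiset" (infixl "\<otimes>" 70) where
  "X \<otimes> y = (\<Sum>x\<in>#X. W x y)"

definition total_grove :: "nat \<Rightarrow> pbt multiset" where
  "total_grove n = mset_set (Y n)"

end

theory Submission
  imports Defs
begin

text \<open>Cutting a tree \<open>z\<close> of degree \<open>p + q\<close> along the path from its root to its leaf number \<open>p\<close>
  yields a pair of trees of degrees \<open>p\<close> and \<open>q\<close>.  Cutting is monotone for the Tamari order and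
  inverts both \<open>over\<close> and \<open>under\<close>, hence \<open>z\<close> lies in the sum \<open>x + y\<close> exactly for this pair \<open>(x, y)\<close>,
  and the sum of the total groves of degrees \<open>p\<close> and \<open>q\<close> is the total grove of degree \<open>p + q\<close>.
  As the total grove \<open>T (n + 1)\<close> is the union of the graftings \<open>T i \<or> T (n - i)\<close>, the product
  \<open>T n \<otimes> T m\<close> is by induction the union of the graftings \<open>T (i * m + k) \<or> T (n * m - 1 - (i * m + k))\<close>
  over \<open>i < n\<close> and \<open>k < m\<close>, and Euclidean division by \<open>m\<close> shows that each index below \<open>n * m\<close> occurs
  exactly once.\<close>

section \<open>Cutting trees\<close>

lemma leaves_degree: "leaves t = Suc (degree t)"
  using leaves_pos[of t] by (simp add: degree_def)

lemma degree_simps [simp]: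
  "degree Bar = 0"
  "degree (Vee l r) = Suc (degree l + degree r)"
  by (simp add: degree_def)
     (metis add_Suc add_Suc_right leaves.simps(2) leaves_degree nat.inject)

lemma in_Y_iff: "t \<in> Y n \<longleftrightarrow> degree t = n"
  by (simp add: Y_def leaves_degree)

lemma degree_over: "degree (over x y) = degree x + degree y"
  by (induction y) auto

lemma tamari_degree: "a \<le>\<^sub>T b \<Longrightarrow> degree a = degree b"
  by (simp add: degree_def tamari_leaves)

text \<open>Leaves are numbered from 0 at the left. A vertex where the path turns left goes to the
  right part, and conversely. An index beyond the last leaf acts like the last leaf.\<close>

primrec cut :: "pbt \<Rightarrow> nat \<Rightarrow> pbt \<times> pbt" where
  "cut Bar n = (Bar, Bar)"
| "cut (Vee l r) n =
    (if n \<le> degree l then map_prod id (\<lambda>a. Vee a r) (cut l n)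
     else map_prod (Vee l) id (cut r (n - Suc (degree l))))"

lemma degree_cut:
  "n \<le> degree z \<Longrightarrow> degree (fst (cut z n)) = n \<and> degree (snd (cut z n)) = degree z - n"
  by (induction z arbitrary: n) auto

lemma cut_0: "cut z 0 = (Bar, z)"
  by (induction z) auto

lemma cut_degree: "cut z (degree z) = (z, Bar)"
  by (induction z) auto

lemma cut_over: "cut (over x y) (degree x) = (x, y)"
  by (induction y) (auto simp: cut_degree degree_over)

lemma cut_under: "cut (under x y) (degree x) = (x, y)"
  by (induction x) (auto simp: cut_0)

text \<open>In a rotation the path ends in \<open>a\<close>, \<open>b\<close> or \<open>c\<close>;
  accordingly the right parts, neither parts, or the left parts differ by a rotation. Under
  grafting, invariance of the degree sends both paths into the same branch.\<close>

lemma cut_mono: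
  "a \<le>\<^sub>T b \<Longrightarrow> fst (cut a n) \<le>\<^sub>T fst (cut b n) \<and> snd (cut a n) \<le>\<^sub>T snd (cut b n)"
proof (induction arbitrary: n rule: tamari.induct)
  case (assoc a b c)
  then show ?case
    by (cases "n \<le> degree a"; cases "n \<le> Suc (degree a + degree b)")
       (auto intro: tamari.intros)
next
  case (graft_left a b c)
  then show ?case
    using tamari_degree[OF graft_left.hyps] by (auto intro: tamari.intros)
qed (auto intro: tamari.intros)

text \<open>One rotation for each vertex on the right spine of \<open>x\<close> carries
  \<open>b\<close> down that spine.\<close>

lemma Vee_under_le: "Vee (under x a) b \<le>\<^sub>T under x (Vee a b)"
proof (induction x)
  case (Vee p q)
  then show ?case
    by (auto intro: tamari.trans[OF tamari.assoc tamari.graft_right])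
qed (simp add: tamari.refl)

text \<open>One rotation for each vertex on the left spine of \<open>y\<close> lifts
  \<open>a\<close> to the root.\<close>

lemma over_Vee_le: "over (Vee a b) y \<le>\<^sub>T Vee a (over b y)"
proof (induction y)
  case (Vee p q)
  then show ?case
    by (auto intro: tamari.trans[OF tamari.graft_left tamari.assoc])
qed (simp add: tamari.refl)

lemma between_cut:
  "n \<le> degree z \<Longrightarrow> over (fst (cut z n)) (snd (cut z n)) \<le>\<^sub>T z \<and>
    z \<le>\<^sub>T under (fst (cut z n)) (snd (cut z n))"
proof (induction z arbitrary: n)
  case (Vee l r)
  show ?case
  proof (cases "n \<le> degree l")
    case True
    \<comment> \<open>The cut puts \<open>r\<close> into the right part. Grafting \<open>r\<close>
      suffices for the lower bound; for the upper bound \<open>r\<close> must also pass down the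
      right spine of the left part. The other case is the mirror image.\<close>
    with Vee.IH(1)[OF True] show ?thesis
      by (auto intro: tamari.graft_left tamari.trans[OF tamari.graft_left Vee_under_le])
  next
    case False
    with Vee.prems have "n - Suc (degree l) \<le> degree r" by simp
    with False Vee.IH(2)[OF this] show ?thesis
      by (auto intro: tamari.graft_right tamari.trans[OF over_Vee_le tamari.graft_right])
  qed
qed (auto intro: tamari.refl)

lemma between_iff_cut:
  assumes "degree z = degree x + degree y"
  shows "over x y \<le>\<^sub>T z \<and> z \<le>\<^sub>T under x y \<longleftrightarrow> cut z (degree x) = (x, y)"
proof
  assume "over x y \<le>\<^sub>T z \<and> z \<le>\<^sub>T under x y"
  \<comment> \<open>Both bounds are cut into \<open>(x, y)\<close>, so monotonicity squeezes the
    parts of \<open>z\<close>.\<close>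
  then have "x \<le>\<^sub>T fst (cut z (degree x))" "y \<le>\<^sub>T snd (cut z (degree x))"
    "fst (cut z (degree x)) \<le>\<^sub>T x" "snd (cut z (degree x)) \<le>\<^sub>T y"
    using cut_mono[of "over x y" z "degree x"] cut_mono[of z "under x y" "degree x"]
    by (auto simp: cut_over cut_under)
  then show "cut z (degree x) = (x, y)"
    by (metis tamari_antisym prod.collapse)
next
  assume "cut z (degree x) = (x, y)"
  then show "over x y \<le>\<^sub>T z \<and> z \<le>\<^sub>T under x y"
    using between_cut[of "degree x" z] assms by simp
qed

lemma count_tree_sum:
  "count (tree_sum x y) z =
    (if degree z = degree x + degree y \<and> cut z (degree x) = (x, y) then 1 else 0)"
proof -
  have "finite {z \<in> Y (degree x + degree y). over x y \<le>\<^sub>T z \<and> z \<le>\<^sub>T under x y}"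
    using finite_Y by simp
  then have "count (tree_sum x y) z =
      (if z \<in> Y (degree x + degree y) \<and> over x y \<le>\<^sub>T z \<and> z \<le>\<^sub>T under x y then 1 else 0)"
    by (simp only: tree_sum_def count_mset_set' mem_Collect_eq simp_thms)
  then show ?thesis
    using between_iff_cut[of z x y] by (auto simp: in_Y_iff)
qed

section \<open>Bilinear extension to groves\<close>

text \<open>Common form of grafting, sum, left sum and right sum. Additivity in each argument
  reduces identities between them to singletons.\<close>

definition bilin :: "(pbt \<Rightarrow> pbt \<Rightarrow> pbt multiset) \<Rightarrow> pbt multiset \<Rightarrow> pbt multiset \<Rightarrow> pbt multiset"
  where "bilin f A B = (\<Sum>x\<in>#A. \<Sum>y\<in>#B. f x y)"

lemma bilin_simps [simp]:
  "bilin f {#} B = {#}"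
  "bilin f A {#} = {#}"
  "bilin f {#x#} {#y#} = f x y"
  "bilin f (A + A') B = bilin f A B + bilin f A' B"
  "bilin f A (B + B') = bilin f A B + bilin f A B'"
  by (simp_all add: bilin_def sum_mset.distrib)

lemma bilin_sum_left: "bilin f (\<Sum>i\<in>I. A i) B = (\<Sum>i\<in>I. bilin f (A i) B)"
  by (induction I rule: infinite_finite_induct) auto

lemma bilin_sum_right: "bilin f A (\<Sum>i\<in>I. B i) = (\<Sum>i\<in>I. bilin f A (B i))"
  by (induction I rule: infinite_finite_induct) auto

text \<open>Since \<open>{#x#}\<close> is \<open>add_mset x {#}\<close>, the \<open>NO_MATCH\<close>
  guards keep these rules from looping.\<close>

lemma bilin_add_mset [simp]:
  "NO_MATCH {#} A \<Longrightarrow> bilin f (add_mset x A) B = bilin f {#x#} B + bilin f A B"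
  "NO_MATCH {#} B \<Longrightarrow> bilin f A (add_mset y B) = bilin f A {#y#} + bilin f A B"
  by (simp_all add: bilin_def sum_mset.distrib)

lemma bilin_total_grove:
  "bilin f (total_grove n) (total_grove m) = (\<Sum>x\<in>Y n. \<Sum>y\<in>Y m. f x y)"
  by (simp add: bilin_def total_grove_def sum_unfold_sum_mset)

abbreviation graft :: "pbt multiset \<Rightarrow> pbt multiset \<Rightarrow> pbt multiset" where
  "graft \<equiv> bilin (\<lambda>l r. {#Vee l r#})"

abbreviation grove_sum :: "pbt multiset \<Rightarrow> pbt multiset \<Rightarrow> pbt multiset" where
  "grove_sum \<equiv> bilin tree_sum"

lemma left_sum_eq_bilin: "A \<stileturn> B = bilin tree_left_sum A B"
  by (simp add: left_sum_def bilin_def)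

lemma right_sum_eq_bilin: "A \<turnstile> B = bilin tree_right_sum A B"
  by (simp add: right_sum_def bilin_def)

lemma image_mset_Vee:
  "image_mset (Vee l) A = graft {#l#} A"
  "image_mset (\<lambda>z. Vee z r) A = graft A {#r#}"
  by (induction A) auto

text \<open>On singletons this is the recursive equation of \<open>tree_left_sum\<close>, which
  changes only the right subtree.\<close>

lemma graft_left_sum: "graft A B \<stileturn> C = graft A (grove_sum B C)"
  unfolding left_sum_eq_bilin
proof (induction A)
  case (add l A)
  have "bilin tree_left_sum (graft {#l#} B) C = graft {#l#} (grove_sum B C)"
  proof (induction B)
    case (add r B)
    have "bilin tree_left_sum {#Vee l r#} C = graft {#l#} (grove_sum {#r#} C)"
      by (induction C) (auto simp: image_mset_Vee)
    with add show ?case by simp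
  qed simp
  with add show ?case by simp
qed simp

lemma right_sum_graft: "C \<turnstile> graft A B = graft (grove_sum C A) B"
  unfolding right_sum_eq_bilin
proof (induction B)
  case (add r B)
  have "bilin tree_right_sum C (graft A {#r#}) = graft (grove_sum C A) {#r#}"
  proof (induction A)
    case (add l A)
    have "bilin tree_right_sum C {#Vee l r#} = graft (grove_sum C {#l#}) {#r#}"
      by (induction C) (auto simp: image_mset_Vee)
    with add show ?case by simp
  qed simp
  with add show ?case by simp
qed simp

lemma grove_product_plus [simp]: "(A + B) \<otimes> y = A \<otimes> y + B \<otimes> y"
  by (simp add: grove_product_def)

lemma grove_product_sum: "(\<Sum>i\<in>I. A i) \<otimes> y = (\<Sum>i\<in>I. A i \<otimes> y)"
  by (induction I rule: infinite_finite_induct) (auto simp: grove_product_def)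

text \<open>Lifts the recursion of \<open>W\<close> to groves, by additivity in \<open>A\<close> and
  \<open>B\<close> with \<open>y\<close> fixed.\<close>

lemma graft_grove_product: "graft A B \<otimes> y = (A \<otimes> y \<turnstile> y) \<stileturn> (B \<otimes> y)"
  unfolding left_sum_eq_bilin right_sum_eq_bilin
proof (induction A)
  case (add l A)
  have "graft {#l#} B \<otimes> y = bilin tree_left_sum (bilin tree_right_sum (W l y) y) (B \<otimes> y)"
    by (induction B) (auto simp: grove_product_def left_sum_eq_bilin right_sum_eq_bilin)
  with add show ?case by (simp add: grove_product_def)
qed (simp add: grove_product_def)

section \<open>Total groves\<close>

lemma grove_sum_total: "grove_sum (total_grove n) (total_grove m) = total_grove (n + m)"
proof (rule multiset_eqI)
  fix z
  have "count (grove_sum (total_grove n) (total_grove m)) z =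
      (\<Sum>(x, y)\<in>Y n \<times> Y m. count (tree_sum x y) z)"
    by (simp add: bilin_total_grove count_sum flip: sum.cartesian_product)
  \<comment> \<open>By \<open>count_tree_sum\<close> only the pair \<open>cut z n\<close> can
    contribute.\<close>
  also have "\<dots> = (\<Sum>p\<in>Y n \<times> Y m. if cut z n = p then (if degree z = n + m then 1 else 0) else 0)"
    by (intro sum.cong) (auto simp: count_tree_sum in_Y_iff)
  also have "\<dots> = (if cut z n \<in> Y n \<times> Y m \<and> degree z = n + m then 1 else 0)"
    by (simp add: finite_Y)
  \<comment> \<open>If \<open>z\<close> has degree \<open>n + m\<close>, the index \<open>n\<close>
    is in range and the two parts have degrees \<open>n\<close> and \<open>m\<close>.\<close>
  also have "\<dots> = (if degree z = n + m then 1 else 0)"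
    using degree_cut[of n z] by (auto simp: in_Y_iff mem_Times_iff)
  finally show "count (grove_sum (total_grove n) (total_grove m)) z = count (total_grove (n + m)) z"
    by (simp add: total_grove_def count_mset_set' finite_Y in_Y_iff)
qed

lemma total_grove_0: "total_grove 0 = {#Bar#}"
proof -
  have "Y 0 = {Bar}"
  proof (intro set_eqI)
    show "t \<in> Y 0 \<longleftrightarrow> t \<in> {Bar}" for t
      by (cases t) (auto simp: in_Y_iff)
  qed
  then show ?thesis by (simp add: total_grove_def)
qed

lemma count_graft_total:
  "count (graft (total_grove i) (total_grove j)) z =
    (case z of Bar \<Rightarrow> 0 | Vee l r \<Rightarrow> if degree l = i \<and> degree r = j then 1 else 0)"
proof (cases z)
  case (Vee a b)
  have "count (graft (total_grove i) (total_grove j)) z =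
      (\<Sum>p\<in>Y i \<times> Y j. if p = (a, b) then 1 else 0)"
    by (auto simp: bilin_total_grove count_sum sum.cartesian_product Vee intro!: sum.cong)
  also have "\<dots> = (if (a, b) \<in> Y i \<times> Y j then 1 else 0)"
    by (simp add: finite_Y)
  finally show ?thesis by (simp add: Vee in_Y_iff)
qed (simp add: bilin_total_grove count_sum)

lemma total_grove_eq_sum_graft:
  assumes "n > 0"
  shows "total_grove n = (\<Sum>i<n. graft (total_grove i) (total_grove (n - Suc i)))"
proof (rule multiset_eqI)
  fix z
  have "count (\<Sum>i<n. graft (total_grove i) (total_grove (n - Suc i))) z =
      (if degree z = n then 1 else 0)"
  proof (cases z)
    case (Vee l r)
    \<comment> \<open>Only \<open>i = degree l\<close> can contribute, and
      \<open>degree z = n\<close> forces this index below \<open>n\<close>.\<close>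
    have "count (\<Sum>i<n. graft (total_grove i) (total_grove (n - Suc i))) z =
        (\<Sum>i<n. if i = degree l then (if degree z = n then 1 else 0) else 0)"
      unfolding count_sum by (intro sum.cong) (auto simp: count_graft_total Vee)
    also have "\<dots> = (if degree z = n then 1 else 0)"
      by (auto simp: Vee)
    finally show ?thesis .
  qed (use assms in \<open>simp add: count_sum count_graft_total\<close>)
  then show "count (total_grove n) z =
      count (\<Sum>i<n. graft (total_grove i) (total_grove (n - Suc i))) z"
    by (simp add: total_grove_def count_mset_set' finite_Y in_Y_iff)
qed

text \<open>Strong induction, because the factors of the decomposition have degrees \<open>i\<close>
  and \<open>n - Suc i\<close>. Positivity of \<open>m\<close> allows the total grove of degree
  \<open>m\<close> to be decomposed as well.\<close>

lemma total_grove_product: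
  assumes "m > 0"
  shows "total_grove n \<otimes> total_grove m = total_grove (n * m)"
proof (induction n rule: less_induct)
  case (less n)
  show ?case
  proof (cases "n = 0")
    case True
    then show ?thesis by (simp add: total_grove_0 grove_product_def)
  next
    case False
    define g where "g p = graft (total_grove p) (total_grove (n * m - Suc p))" for p
    \<comment> \<open>The graftings with left degree \<open>i\<close> fill a block of
      \<open>m\<close> consecutive left degrees starting at \<open>i * m\<close>.\<close>
    have step: "(total_grove (i * m) \<turnstile> total_grove m) \<stileturn> total_grove ((n - Suc i) * m) =
        sum g {i * m..<i * m + m}" if "i < n" for i
    proof -
      have deg: "m - Suc k + (n - Suc i) * m = n * m - Suc (i * m + k)" if "k < m" for k
      proof -
        \<comment> \<open>This form of \<open>n\<close> eliminates the truncated
          subtractions.\<close>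
        obtain d where "n = Suc (i + d)" using \<open>i < n\<close> less_imp_Suc_add by blast
        with that show ?thesis by (simp add: algebra_simps)
      qed
      have "total_grove (i * m) \<turnstile> total_grove m =
          (\<Sum>k<m. graft (total_grove (i * m + k)) (total_grove (m - Suc k)))"
        by (subst total_grove_eq_sum_graft[OF assms])
           (simp add: right_sum_eq_bilin bilin_sum_right grove_sum_total
             right_sum_graft[unfolded right_sum_eq_bilin])
      then have "(total_grove (i * m) \<turnstile> total_grove m) \<stileturn> total_grove ((n - Suc i) * m) =
          (\<Sum>k<m. graft (total_grove (i * m + k)) (total_grove (m - Suc k + (n - Suc i) * m)))"
        by (simp add: left_sum_eq_bilin bilin_sum_left grove_sum_total
             graft_left_sum[unfolded left_sum_eq_bilin])
      also have "\<dots> = (\<Sum>k<m. g (i * m + k))"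
      proof (rule sum.cong)
        fix k assume "k \<in> {..<m}"
        then have "k < m" by simp
        show "graft (total_grove (i * m + k)) (total_grove (m - Suc k + (n - Suc i) * m)) =
            g (i * m + k)"
          unfolding g_def deg[OF \<open>k < m\<close>] ..
      qed simp
      also have "\<dots> = sum g {i * m..<i * m + m}"
        using sum.shift_bounds_nat_ivl[of g 0 "i * m" m]
        by (simp add: atLeast0LessThan add.commute)
      finally show ?thesis .
    qed
    have "total_grove n \<otimes> total_grove m =
        (\<Sum>i<n. (total_grove i \<otimes> total_grove m \<turnstile> total_grove m) \<stileturn>
          (total_grove (n - Suc i) \<otimes> total_grove m))"
      using False by (subst total_grove_eq_sum_graft)
        (simp_all add: grove_product_sum graft_grove_product)
    also have "\<dots> = (\<Sum>i<n. sum g {i * m..<i * m + m})"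
      using less.IH step by (intro sum.cong) auto
    \<comment> \<open>The \<open>n\<close> blocks of length \<open>m\<close> tile the indices below
      \<open>n * m\<close>.\<close>
    also have "\<dots> = sum g {..<n * m}"
      by (rule sum.nat_group)
    also have "\<dots> = total_grove (n * m)"
      using False assms by (subst total_grove_eq_sum_graft) (auto simp: g_def)
    finally show ?thesis .
  qed
qed

section \<open>The degenerate factor of degree 0\<close>

lemma W_singleton_Bar: "W x {#Bar#} = {#Bar#}"
  by (induction x) (auto simp: left_sum_def right_sum_def)

lemma set_grove_product: "set_mset (X \<otimes> y) = (\<Union>x\<in>set_mset X. set_mset (W x y))"
  by (induction X) (auto simp: grove_product_def)

text \<open>For \<open>m = 0\<close> the product has one copy of \<open>Bar\<close> per tree of
  \<open>Y n\<close>, so multiplicities agree only if \<open>Y n\<close> is a singleton, that is for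
  \<open>n \<le> 1\<close>.\<close>

theorem theorem6p4:
  fixes n m :: nat
  shows "set_mset (total_grove n \<otimes> total_grove m) = set_mset (total_grove (n * m)) \<and>
    (m \<ge> 1 \<or> n \<le> 1 \<longrightarrow> total_grove n \<otimes> total_grove m = total_grove (n * m))"
proof (cases "m = 0")
  case True
  have T1: "total_grove 1 = {#Vee Bar Bar#}"
    by (subst total_grove_eq_sum_graft) (auto simp: total_grove_0)
  \<comment> \<open>The right comb witnesses that \<open>Y n\<close> is nonempty, so that
    \<open>Bar\<close> does occur in the product.\<close>
  have "degree ((Vee Bar ^^ n) Bar) = n"
    by (induction n) auto
  then have "total_grove n \<noteq> {#}"
    by (auto simp: total_grove_def mset_set_empty_iff finite_Y in_Y_iff)
  then have "set_mset (total_grove n \<otimes> total_grove 0) = {Bar}"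
    by (auto simp: set_grove_product total_grove_0 W_singleton_Bar)
  moreover have "total_grove n \<otimes> total_grove 0 = total_grove 0" if "n \<le> 1"
    using that T1 by (cases "n = 0")
      (auto simp: total_grove_0 grove_product_def W_singleton_Bar le_Suc_eq simp del: W.simps)
  ultimately show ?thesis using True by (auto simp: total_grove_0)
next
  case False
  then show ?thesis using total_grove_product by simp
qed

end
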